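(* Suppose the acceptance functions $p_v$ ($v\in V$) satisfy Assumption 1 (stated in the context). Let $(\boldsymbol z^*,\boldsymbol z^{s*},\boldsymbol z^{t*},z_{(s,t)}^* )$ be an optimal solution of the problem (FP), and define $x_v^* := \bar\xi_v^{-1}\big(\sum_{e\in\delta(v)} z_e^*\big)$ for all $v\in V$. Then $\boldsymbol x^*=(x_v^* )_{v\in V}$ is a $(1-1/e)$-approximate solution of (P): $x_v^*\in\mathcal X_v$ for all $v\in V$, and $$\mathbb E_{\boldsymbol\xi\sim D(\boldsymbol x^* )}[f(\boldsymbol x^*,\boldsymbol\xi)]\ \ge\ (1-1/e)\,\mathbb E_{\boldsymbol\xi\sim D(\boldsymbol x)}[f(\boldsymbol x,\boldsymbol\xi)]$$ for every $\boldsymbol x\in\prod_{v\in V}\mathcal X_v$.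
   Context: Setting. $G=(U,V,E)$ is a finite bipartite graph with edges $e=(u,v)$, $u\in U$, $v\in V$; $\delta(a)$ is the set of edges incident to node $a$, assumed non-empty for every $a\in U\cup V$. Each edge $e$ has a weight $w_e\in\mathbb R$; each $u\in U$ has a capacity $c_u\in\mathbb Z_{>0}$. For each $v\in V$: $n_v$ is a positive integer, $\mathcal X_v\subseteq\mathbb R$ is a non-empty interval, $p_v:\mathcal X_v\to\mathcal Z_v\subseteq[0,1]$ is a function, and $\bar\xi_v(x):=n_vp_v(x)$, a map from $\mathcal X_v$ to $n_v\mathcal Z_v:=\{n_vz: z\in\mathcal Z_v\}$. It is assumed that for each $v\in V$ there is $x_v\in\mathcal X_v$ with $x_v>-\max_{e\in\delta(v)}w_e$. Distribution. For $\boldsymbol x\in\prod_v\mathcal X_v$, $D(\boldsymbol x)=\prod_{v\in V}D_v(\boldsymbol x)$ is the product distribution (independent coordinates), where either $D_v(\boldsymbol x)=\mathrm{Bin}(n_v,p_v(x_v))$ for all $v$, or $D_v(\boldsymbol x)=\mathrm{Poisson}(n_vp_v(x_v))$ for all $v$. Problem (P): maximize $\mathbb E_{\boldsymbol\xi\sim D(\boldsymbol x)}[f(\boldsymbol x,\boldsymbol\xi)]$ subject to $x_v\in\mathcal X_v$ for all $v\in V$, where $f(\boldsymbol x,\boldsymbol\xi)$ is the optimal value of the b-matching problem: maximize $\sum_{e=(u,v)\in E}(w_e+x_v)z_e$ over $\boldsymbol z\in\mathbb Z_{\ge0}^E$ subject to $\sum_{e\in\delta(v)}z_e\le\xi_v$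 for all $v\in V$ and $\sum_{e\in\delta(u)}z_e\le c_u$ for all $u\in U$. Assumption 1. For all $v\in V$: (a) $p_v$ is differentiable, strictly decreasing, and bijective from $\mathcal X_v$ onto $\mathcal Z_v$; (b) if $\mathcal X_v$ is bounded from above, then $\max\mathcal X_v$ exists and $p_v(\max\mathcal X_v)=0$; if $\mathcal X_v$ is unbounded from above, then $\lim_{x\to\infty}p_v(x)=0$; (c) $p_v'(x)/p_v(x)$ is monotonically non-increasing on the interior of $\mathcal X_v$. Under Assumption 1, $\bar\xi_v$ is a bijection from $\mathcal X_v$ onto $n_v\mathcal Z_v$ with inverse $\bar\xi_v^{-1}$. Problem (FP): with $C:=\min\{\sum_{v\in V}\sup(n_v\mathcal Z_v),\ \sum_{u\in U}c_u\}$, minimize $$\sum_{v\in V}-\bar\xi_v^{-1}(z_{(v,t)})\,z_{(v,t)}-\sum_{e\in E}w_ez_e$$ over $\boldsymbol z\in\mathbb R^E$, $\boldsymbol z^s=(z_{(s,u)})_{u\in U}\in\mathbb R^U$, $\boldsymbol z^t=(z_{(v,t)})_{v\in V}\in\mathbb R^V$, $z_{(s,t)}\in\mathbb R$, subject to: $\sum_{u\in U}z_{(s,u)}+z_{(s,t)}=C$; $\sum_{v\in V}z_{(v,t)}+z_{(s,t)}=C$; $z_{(s,u)}-\sum_{e\in\delta(u)}z_e=0$ for all $u\in U$; $\sum_{e\in\delta(v)}z_e-z_{(v,t)}=0$ for all $v\in V$; $\sum_{e\in\delta(v)}z_e\in n_v\mathcal Z_v$ for all $v\in V$; $z_e\ge0$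 for all $e\in E$; $0\le z_{(s,u)}\le c_u$ for all $u\in U$; $0\le z_{(s,t)}\le C$. *)

theory Defs
  imports "HOL-Probability.Probability"
begin

text \<open>
  A finite bipartite graph is given by node sets \<open>U\<close>, \<open>V\<close> (of possibly different types, hence
  disjoint) and an edge set \<open>E \<subseteq> U \<times> V\<close>.
\<close>

definition edgesU :: "('u \<times> 'v) set \<Rightarrow> 'u \<Rightarrow> ('u \<times> 'v) set" where
  "edgesU E u = {e \<in> E. fst e = u}"

definition edgesV :: "('u \<times> 'v) set \<Rightarrow> 'v \<Rightarrow> ('u \<times> 'v) set" where
  "edgesV E v = {e \<in> E. snd e = v}"

definition mean_demand :: "('v \<Rightarrow> nat) \<Rightarrow> ('v \<Rightarrow> real \<Rightarrow> real) \<Rightarrow> 'v \<Rightarrow> real \<Rightarrow> real" where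
  "mean_demand n p v x = real (n v) * p v x"

definition mean_demand_inv ::
  "('v \<Rightarrow> nat) \<Rightarrow> ('v \<Rightarrow> real set) \<Rightarrow> ('v \<Rightarrow> real \<Rightarrow> real) \<Rightarrow> 'v \<Rightarrow> real \<Rightarrow> real" where
  "mean_demand_inv n X p v = inv_into (X v) (mean_demand n p v)"

datatype demand_model = Binomial_Demand | Poisson_Demand

text \<open>
  The library's \<^const>\<open>poisson_pmf\<close> is only specified for positive rates, so the Poisson
  distribution with rate \<open>0\<close>, which occurs when \<open>p v x = 0\<close>, is given explicitly as the point
  mass at \<open>0\<close>.
\<close>

fun demand_pmf :: "demand_model \<Rightarrow> nat \<Rightarrow> real \<Rightarrow> nat pmf" where
  "demand_pmf Binomial_Demand m q = binomial_pmf m q"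
| "demand_pmf Poisson_Demand m q =
     (if real m * q = 0 then return_pmf 0 else poisson_pmf (real m * q))"

definition demand_dist ::
  "demand_model \<Rightarrow> 'v set \<Rightarrow> ('v \<Rightarrow> nat) \<Rightarrow> ('v \<Rightarrow> real \<Rightarrow> real) \<Rightarrow> ('v \<Rightarrow> real) \<Rightarrow> ('v \<Rightarrow> nat) pmf"
where
  "demand_dist M V n p x = Pi_pmf V 0 (\<lambda>v. demand_pmf M (n v) (p v (x v)))"

definition b_matchings ::
  "'u set \<Rightarrow> 'v set \<Rightarrow> ('u \<times> 'v) set \<Rightarrow> ('u \<Rightarrow> nat) \<Rightarrow> ('v \<Rightarrow> nat) \<Rightarrow> ('u \<times> 'v \<Rightarrow> nat) set" where
  "b_matchings U V E c \<xi> =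
     {z. (\<forall>v\<in>V. (\<Sum>e\<in>edgesV E v. z e) \<le> \<xi> v) \<and> (\<forall>u\<in>U. (\<Sum>e\<in>edgesU E u. z e) \<le> c u)}"

text \<open>
  For a finite edge set \<open>E \<subseteq> U \<times> V\<close> the supremum below is a maximum: \<open>z = 0\<close> is feasible, and the
  capacities bound every \<open>z e\<close> with \<open>e \<in> E\<close>.
\<close>

definition b_matching_value ::
  "'u set \<Rightarrow> 'v set \<Rightarrow> ('u \<times> 'v) set \<Rightarrow> ('u \<times> 'v \<Rightarrow> real) \<Rightarrow> ('u \<Rightarrow> nat) \<Rightarrow>
   ('v \<Rightarrow> real) \<Rightarrow> ('v \<Rightarrow> nat) \<Rightarrow> real"
where
  "b_matching_value U V E w c x \<xi> =
     (SUP z \<in> b_matchings U V E c \<xi>. \<Sum>e\<in>E. (w e + x (snd e)) * real (z e))"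

definition expected_value ::
  "demand_model \<Rightarrow> 'u set \<Rightarrow> 'v set \<Rightarrow> ('u \<times> 'v) set \<Rightarrow> ('u \<times> 'v \<Rightarrow> real) \<Rightarrow> ('u \<Rightarrow> nat) \<Rightarrow>
   ('v \<Rightarrow> nat) \<Rightarrow> ('v \<Rightarrow> real \<Rightarrow> real) \<Rightarrow> ('v \<Rightarrow> real) \<Rightarrow> real"
where
  "expected_value M U V E w c n p x =
     measure_pmf.expectation (demand_dist M V n p x) (b_matching_value U V E w c x)"

text \<open>
  \<open>acceptance_function X Z p\<close> is the assumption on one acceptance function \<open>p : X \<rightarrow> Z\<close>.
  Differentiability is relative to \<open>X\<close>, i.e. one-sided at an endpoint belonging to \<open>X\<close>.
\<close>

definition acceptance_function :: "real set \<Rightarrow> real set \<Rightarrow> (real \<Rightarrow> real) \<Rightarrow> bool" where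
  "acceptance_function X Z p \<longleftrightarrow>
     p differentiable_on X \<and> strict_antimono_on X p \<and> bij_betw p X Z \<and>
     (bdd_above X \<longrightarrow> (\<exists>m\<in>X. (\<forall>x\<in>X. x \<le> m) \<and> p m = 0)) \<and>
     (\<not> bdd_above X \<longrightarrow> (p \<longlongrightarrow> 0) at_top) \<and>
     antimono_on (interior X) (\<lambda>x. deriv p x / p x)"

definition flow_capacity ::
  "'u set \<Rightarrow> 'v set \<Rightarrow> ('u \<Rightarrow> nat) \<Rightarrow> ('v \<Rightarrow> nat) \<Rightarrow> ('v \<Rightarrow> real set) \<Rightarrow> real" where
  "flow_capacity U V c n Z =
     min (\<Sum>v\<in>V. Sup ((\<lambda>q. real (n v) * q) ` Z v)) (\<Sum>u\<in>U. real (c u))"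

text \<open>
  In the flow problem \<open>z\<close>, \<open>zs\<close>, \<open>zt\<close>, \<open>zst\<close> are the flows on the edges of the graph, on the arcs
  \<open>(s,u)\<close>, on the arcs \<open>(v,t)\<close> and on the arc \<open>(s,t)\<close>.
\<close>

definition FP_feasible ::
  "'u set \<Rightarrow> 'v set \<Rightarrow> ('u \<times> 'v) set \<Rightarrow> ('u \<Rightarrow> nat) \<Rightarrow> ('v \<Rightarrow> nat) \<Rightarrow> ('v \<Rightarrow> real set) \<Rightarrow>
   ('u \<times> 'v \<Rightarrow> real) \<Rightarrow> ('u \<Rightarrow> real) \<Rightarrow> ('v \<Rightarrow> real) \<Rightarrow> real \<Rightarrow> bool"
where
  "FP_feasible U V E c n Z z zs zt zst \<longleftrightarrow>
     (\<Sum>u\<in>U. zs u) + zst = flow_capacity U V c n Z \<and>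
     (\<Sum>v\<in>V. zt v) + zst = flow_capacity U V c n Z \<and>
     (\<forall>u\<in>U. zs u - (\<Sum>e\<in>edgesU E u. z e) = 0) \<and>
     (\<forall>v\<in>V. (\<Sum>e\<in>edgesV E v. z e) - zt v = 0) \<and>
     (\<forall>v\<in>V. (\<Sum>e\<in>edgesV E v. z e) \<in> (\<lambda>q. real (n v) * q) ` Z v) \<and>
     (\<forall>e\<in>E. 0 \<le> z e) \<and>
     (\<forall>u\<in>U. 0 \<le> zs u \<and> zs u \<le> real (c u)) \<and>
     0 \<le> zst \<and> zst \<le> flow_capacity U V c n Z"

definition FP_objective ::
  "'v set \<Rightarrow> ('u \<times> 'v) set \<Rightarrow> ('u \<times> 'v \<Rightarrow> real) \<Rightarrow> ('v \<Rightarrow> nat) \<Rightarrow> ('v \<Rightarrow> real set) \<Rightarrow>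
   ('v \<Rightarrow> real \<Rightarrow> real) \<Rightarrow> ('u \<times> 'v \<Rightarrow> real) \<Rightarrow> ('v \<Rightarrow> real) \<Rightarrow> real"
where
  "FP_objective V E w n X p z zt =
     (\<Sum>v\<in>V. - mean_demand_inv n X p v (zt v) * zt v) - (\<Sum>e\<in>E. w e * z e)"

definition FP_optimal ::
  "'u set \<Rightarrow> 'v set \<Rightarrow> ('u \<times> 'v) set \<Rightarrow> ('u \<times> 'v \<Rightarrow> real) \<Rightarrow> ('u \<Rightarrow> nat) \<Rightarrow> ('v \<Rightarrow> nat) \<Rightarrow>
   ('v \<Rightarrow> real set) \<Rightarrow> ('v \<Rightarrow> real set) \<Rightarrow> ('v \<Rightarrow> real \<Rightarrow> real) \<Rightarrow>
   ('u \<times> 'v \<Rightarrow> real) \<Rightarrow> ('u \<Rightarrow> real) \<Rightarrow> ('v \<Rightarrow> real) \<Rightarrow> real \<Rightarrow> bool"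
where
  "FP_optimal U V E w c n X Z p z zs zt zst \<longleftrightarrow>
     FP_feasible U V E c n Z z zs zt zst \<and>
     (\<forall>z' zs' zt' zst'. FP_feasible U V E c n Z z' zs' zt' zst' \<longrightarrow>
        FP_objective V E w n X p z zt \<le> FP_objective V E w n X p z' zt')"

end

theory Submission
  imports Defs
begin

text \<open>
  For a price vector \<open>x\<close> let \<open>L(x)\<close> be the maximum of \<open>\<Sum>e. (w e + x (snd e)) * y e\<close> over
  fractional b-matchings \<open>y\<close>, where the random capacity of each \<open>v\<close> is replaced by its mean. Three
  inequalities give the theorem.

  The mean of an optimal integral b-matching is a fractional b-matching, so the expected optimum is
  at most \<open>L(x)\<close> (\<open>expected_value_le_fractional\<close>).

  The flow problem maximizes the same linear value while letting each price adapt to the flow. A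
  fractional b-matching for the prices \<open>x\<close> puts at most the mean demand on each \<open>v\<close>; since demand
  decreases continuously to \<open>0\<close> as the price rises, some price at least \<open>x v\<close> has exactly that flow as
  mean demand if the flow is positive, and raising the price only increases the value; flows that
  vanish at \<open>v\<close> are treated by a limit. Hence the optimal value of the flow problem
  is at least \<open>L(x)\<close> (\<open>FP_optimal_ge_fractional\<close>).

  Conversely, at any prices every fractional b-matching \<open>z\<close> can be rounded keeping at
  least the fraction \<open>1 - 1/e\<close> of its value (\<open>expected_value_ge_fractional\<close>); this is applied to the optimal flow. Split each \<open>u\<close>
  into \<open>c u\<close> unit slots. Every unit of demand at \<open>v\<close> independently picks a slot of \<open>u\<close> with
  probability proportional to \<open>z (u, v)\<close>, and every slot keeps the most valuable unit that picked it.
  For binomial and for Poisson demand alike, the generating function of the demand is at most that of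
  the Poisson distribution with the same mean (\<open>demand_pmf_mean_and_pgf\<close>). Therefore a set \<open>A\<close> of
  nodes misses a slot with probability at most \<open>exp (- q)\<close>, where \<open>q \<le> 1\<close> is the expected number of
  units from \<open>A\<close> in that slot, and hits it with probability at least \<open>1 - exp (- q) \<ge> (1 - 1/e) * q\<close>
  (\<open>prob_hit_ge\<close>). Decomposing the rewards into their superlevel sets turns this bound for sets into
  the bound for the expected maximal reward (\<open>expected_best_ge\<close>).
\<close>

section \<open>Binomial and Poisson demand\<close>

definition mean_at_most :: "nat pmf \<Rightarrow> real \<Rightarrow> bool" where
  "mean_at_most D \<mu> \<longleftrightarrow> (\<integral>\<^sup>+k. ennreal (real k) \<partial>measure_pmf D) \<le> ennreal \<mu>"

text \<open>
  The right-hand side is the generating function of the Poisson distribution with mean \<open>\<mu>\<close>. This is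
  the only property of the demand used in the rounding argument.
\<close>

definition pgf_below_poisson :: "nat pmf \<Rightarrow> real \<Rightarrow> bool" where
  "pgf_below_poisson D \<mu> \<longleftrightarrow>
     (\<forall>s\<in>{0..1}. (\<integral>\<^sup>+k. ennreal (s ^ k) \<partial>measure_pmf D) \<le> ennreal (exp (- (1 - s) * \<mu>)))"

lemma nn_integral_poisson:
  fixes f :: "nat \<Rightarrow> real"
  assumes "0 < r" "\<And>k. 0 \<le> f k" "(\<lambda>k. r ^ k / fact k * exp (- r) * f k) sums S"
  shows "(\<integral>\<^sup>+k. ennreal (f k) \<partial>measure_pmf (poisson_pmf r)) = ennreal S"
proof -
  have "(\<integral>\<^sup>+k. ennreal (f k) \<partial>measure_pmf (poisson_pmf r))
      = (\<Sum>k. ennreal (r ^ k / fact k * exp (- r) * f k))"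
    using assms
    by (simp add: nn_integral_measure_pmf nn_integral_count_space_nat ennreal_mult'[symmetric])
  also have "\<dots> = ennreal S"
    using assms by (intro suminf_ennreal_eq) auto
  finally show ?thesis .
qed

lemma pgf_poisson:
  assumes "0 < r"
  shows "pgf_below_poisson (poisson_pmf r) r"
  unfolding pgf_below_poisson_def
proof
  fix s :: real assume s: "s \<in> {0..1}"
  have "(\<lambda>k. exp (- r) * ((r * s) ^ k /\<^sub>R fact k)) sums (exp (- r) * exp (r * s))"
    by (intro sums_mult exp_converges)
  then have "(\<lambda>k. r ^ k / fact k * exp (- r) * s ^ k) sums exp (- (1 - s) * r)"
    by (simp add: exp_add[symmetric] power_mult_distrib scaleR_conv_of_real field_simps)
  then have "(\<integral>\<^sup>+k. ennreal (s ^ k) \<partial>measure_pmf (poisson_pmf r)) = ennreal (exp (- (1 - s) * r))"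
    using s assms by (intro nn_integral_poisson) auto
  then show "(\<integral>\<^sup>+k. ennreal (s ^ k) \<partial>measure_pmf (poisson_pmf r)) \<le> ennreal (exp (- (1 - s) * r))"
    by simp
qed

lemma mean_poisson:
  assumes "0 < r"
  shows "mean_at_most (poisson_pmf r) r"
proof -
  have "(\<lambda>k. r * exp (- r) * (r ^ k /\<^sub>R fact k)) sums (r * exp (- r) * exp r)"
    by (intro sums_mult exp_converges)
  moreover have "r ^ Suc k / fact (Suc k) * exp (- r) * real (Suc k)
      = r * exp (- r) * (r ^ k /\<^sub>R fact k)" for k
    by (simp add: scaleR_conv_of_real divide_simps)
  moreover have "r * exp (- r) * exp r = r"
    by (simp add: exp_minus)
  ultimately have "(\<lambda>k. r ^ Suc k / fact (Suc k) * exp (- r) * real (Suc k)) sums r"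
    by simp
  then have "(\<lambda>k. r ^ k / fact k * exp (- r) * real k) sums r"
    by (subst (asm) sums_Suc_iff) simp
  then show ?thesis
    unfolding mean_at_most_def using assms by (subst nn_integral_poisson) auto
qed

lemma nn_integral_binomial:
  fixes f :: "nat \<Rightarrow> real"
  assumes "q \<in> {0..1}" "\<And>k. 0 \<le> f k"
  shows "(\<integral>\<^sup>+k. ennreal (f k) \<partial>measure_pmf (binomial_pmf m q))
    = ennreal (\<Sum>k\<le>m. real (m choose k) * q ^ k * (1 - q) ^ (m - k) * f k)"
  using assms by (subst nn_integral_eq_integral) (auto simp: expectation_binomial_pmf')

text \<open>
  The generating function is \<open>(1 - (1 - s) * q) ^ m\<close>, and \<open>1 - t \<le> exp (- t)\<close>.
\<close>

lemma pgf_binomial: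
  assumes "q \<in> {0..1}"
  shows "pgf_below_poisson (binomial_pmf m q) (real m * q)"
  unfolding pgf_below_poisson_def
proof
  fix s :: real assume s: "s \<in> {0..1}"
  have "(\<Sum>k\<le>m. real (m choose k) * q ^ k * (1 - q) ^ (m - k) * s ^ k)
      = (q * s + (1 - q)) ^ m"
    by (simp add: binomial_ring power_mult_distrib mult_ac)
  also have "\<dots> \<le> exp (- (1 - s) * q) ^ m"
  proof (rule power_mono)
    show "q * s + (1 - q) \<le> exp (- (1 - s) * q)"
      using exp_ge_add_one_self[of "- (1 - s) * q"] by (simp add: algebra_simps)
    show "0 \<le> q * s + (1 - q)"
      using s assms by (intro add_nonneg_nonneg mult_nonneg_nonneg) auto
  qed
  also have "\<dots> = exp (- (1 - s) * (real m * q))"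
    by (simp add: exp_of_nat_mult[symmetric] algebra_simps)
  finally show "(\<integral>\<^sup>+k. ennreal (s ^ k) \<partial>measure_pmf (binomial_pmf m q))
      \<le> ennreal (exp (- (1 - s) * (real m * q)))"
    using s assms by (simp add: nn_integral_binomial ennreal_leI)
qed

lemma mean_binomial:
  assumes "q \<in> {0..1}"
  shows "mean_at_most (binomial_pmf m q) (real m * q)"
proof -
  have "(\<Sum>k\<le>m. real (m choose k) * q ^ k * (1 - q) ^ (m - k) * real k) = real m * q"
    using sum_k_Bernstein[of m q] by (simp add: Bernstein_def mult_ac)
  then show ?thesis
    using assms by (simp add: mean_at_most_def nn_integral_binomial)
qed

text \<open>
  What makes one proof work for both demand models. Poisson demand of rate \<open>0\<close> needs a case of its own
  because it is a point mass.
\<close>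

lemma demand_pmf_mean_and_pgf:
  assumes "q \<in> {0..1}"
  shows "mean_at_most (demand_pmf M m q) (real m * q)"
    and "pgf_below_poisson (demand_pmf M m q) (real m * q)"
proof -
  have "mean_at_most (demand_pmf M m q) (real m * q) \<and>
    pgf_below_poisson (demand_pmf M m q) (real m * q)"
  proof (cases M)
    case Binomial_Demand
    then show ?thesis
      using mean_binomial[OF assms] pgf_binomial[OF assms] by simp
  next
    case Poisson_Demand
    have "0 \<le> real m * q" using assms by simp
    then consider "real m * q = 0" | "0 < real m * q" by linarith
    then show ?thesis
    proof cases
      case 1
      have "mean_at_most (return_pmf 0) 0" "pgf_below_poisson (return_pmf 0) 0"
        by (auto simp: mean_at_most_def pgf_below_poisson_def)
      with 1 Poisson_Demand show ?thesis by (simp only: demand_pmf.simps refl if_True)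
    next
      case 2
      with mean_poisson[OF 2] pgf_poisson[OF 2] Poisson_Demand show ?thesis
        by (simp only: demand_pmf.simps if_False less_imp_neq[OF 2, symmetric])
    qed
  qed
  then show "mean_at_most (demand_pmf M m q) (real m * q)"
    and "pgf_below_poisson (demand_pmf M m q) (real m * q)"
    by blast+
qed

section \<open>Random arrivals at a slot\<close>

text \<open>
  Subprobabilities on \<open>S\<close> are completed by the outcome \<open>None\<close>: a unit of demand that picks no slot.
\<close>

lemma exists_option_pmf:
  fixes \<rho> :: "'a \<Rightarrow> real"
  assumes "finite S" "\<And>s. s \<in> S \<Longrightarrow> 0 \<le> \<rho> s" "sum \<rho> S \<le> 1"
  shows "\<exists>C. \<forall>s\<in>S. pmf C (Some s) = \<rho> s"
proof -
  define f where "f = (\<lambda>a. case a of None \<Rightarrow> 1 - sum \<rho> S | Some s \<Rightarrow> if s \<in> S then \<rho> s else 0)"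
  have nonneg: "0 \<le> f a" for a
    using assms by (auto simp: f_def split: option.split)
  have "(\<integral>\<^sup>+a. ennreal (f a) \<partial>count_space UNIV) = (\<Sum>a\<in>insert None (Some ` S). ennreal (f a))"
    using assms(1) by (intro nn_integral_count_space') (auto simp: f_def split: option.splits)
  also have "\<dots> = ennreal (sum f (insert None (Some ` S)))"
    using nonneg by (intro sum_ennreal) auto
  also have "sum f (insert None (Some ` S)) = 1"
    using assms(1) by (simp add: f_def sum.reindex)
  finally have "(\<integral>\<^sup>+a. ennreal (f a) \<partial>count_space UNIV) = 1" by simp
  then have "\<forall>s\<in>S. pmf (embed_pmf f) (Some s) = \<rho> s"
    using nonneg by (simp add: pmf_embed_pmf f_def)
  then show ?thesis ..
qed

lemma emeasure_replicate_pmf_avoid: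
  "emeasure (measure_pmf (replicate_pmf k C)) {xs. a \<notin> set xs} = ennreal ((1 - pmf C a) ^ k)"
proof (induction k)
  case 0
  then show ?case by simp
next
  case (Suc k)
  have "emeasure (measure_pmf (replicate_pmf (Suc k) C)) {xs. a \<notin> set xs}
      = (\<integral>\<^sup>+x. \<integral>\<^sup>+xs. indicator (- {a}) x * indicator {xs. a \<notin> set xs} xs
           \<partial>measure_pmf (replicate_pmf k C) \<partial>measure_pmf C)"
    by (auto intro!: nn_integral_cong simp: indicator_def)
  also have "\<dots> = emeasure (measure_pmf C) (- {a}) * ennreal ((1 - pmf C a) ^ k)"
    by (simp add: nn_integral_cmult nn_integral_multc Suc)
  also have "emeasure (measure_pmf C) (- {a}) = ennreal (1 - pmf C a)"
    using measure_pmf.prob_compl[of "{a}" C]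
    by (simp add: measure_pmf.emeasure_eq_measure Compl_eq_Diff_UNIV measure_pmf_single)
  finally show ?case
    by (simp add: ennreal_mult'[symmetric] pmf_le_1)
qed

text \<open>
  A demand of random size together with the independent choices of its units. The list keeps the
  demand as its length, so the demand and the choices live on one probability space.
\<close>

definition arrivals_pmf :: "nat pmf \<Rightarrow> 'a pmf \<Rightarrow> 'a list pmf" where
  "arrivals_pmf D C = bind_pmf D (\<lambda>k. replicate_pmf k C)"

lemma map_length_arrivals_pmf: "map_pmf length (arrivals_pmf D C) = D"
proof -
  have "map_pmf length (replicate_pmf k C) = return_pmf k" for k
  proof -
    have "map_pmf length (replicate_pmf k C) = map_pmf (\<lambda>_. k) (replicate_pmf k C)"
      by (intro map_pmf_cong refl) (auto simp: set_replicate_pmf)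
    then show ?thesis by simp
  qed
  then show ?thesis
    by (simp add: arrivals_pmf_def map_bind_pmf bind_return_pmf')
qed

text \<open>
  Given demand \<open>k\<close>, all units avoid \<open>a\<close> with probability \<open>(1 - pmf C a) ^ k\<close>, so the probability is
  the generating function of the demand at \<open>1 - pmf C a\<close>.
\<close>

lemma prob_arrivals_avoid:
  assumes "pgf_below_poisson D \<mu>"
  shows "measure_pmf.prob (arrivals_pmf D C) {xs. a \<notin> set xs} \<le> exp (- pmf C a * \<mu>)"
proof -
  have "emeasure (measure_pmf (arrivals_pmf D C)) {xs. a \<notin> set xs}
      = (\<integral>\<^sup>+k. ennreal ((1 - pmf C a) ^ k) \<partial>measure_pmf D)"
    by (simp add: arrivals_pmf_def emeasure_replicate_pmf_avoid)
  also have "\<dots> \<le> ennreal (exp (- (1 - (1 - pmf C a)) * \<mu>))"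
    using assms unfolding pgf_below_poisson_def
    by (rule bspec) (auto simp: pmf_le_1)
  finally show ?thesis
    by (simp add: measure_pmf.emeasure_eq_measure)
qed

section \<open>Keeping the best arrival\<close>

text \<open>
  The inserted \<open>0\<close> is the value of a slot that nobody picked.
\<close>

definition best :: "('a \<Rightarrow> real) \<Rightarrow> 'a set \<Rightarrow> real" where
  "best r S = Max (insert 0 (r ` S))"

lemma best_nonneg: "finite S \<Longrightarrow> 0 \<le> best r S"
  by (simp add: best_def)

lemma best_le: "finite S \<Longrightarrow> 0 \<le> b \<Longrightarrow> (\<And>a. a \<in> S \<Longrightarrow> r a \<le> b) \<Longrightarrow> best r S \<le> b"
  by (auto simp: best_def)

lemma best_ge: "finite S \<Longrightarrow> a \<in> S \<Longrightarrow> r a \<le> best r S"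
  by (auto simp: best_def)

lemma best_cases:
  assumes "finite S"
  obtains "best r S = 0" | a where "a \<in> S" "best r S = r a"
  using Max_in[of "insert 0 (r ` S)"] assms by (auto simp: best_def)

text \<open>
  One layer of the layer-cake decomposition of \<open>r\<close>: subtracting the least positive reward \<open>m\<close> from all
  positive rewards lowers the maximum by \<open>m\<close> exactly when the support is hit.
\<close>

lemma best_peel:
  fixes r :: "'a \<Rightarrow> real"
  assumes "finite V" "\<And>v. v \<in> V \<Longrightarrow> 0 \<le> r v" and A: "A = {v \<in> V. r v \<noteq> 0}" "A \<noteq> {}"
  defines "m \<equiv> Min (r ` A)"
  shows "best r (S \<inter> V)
    = m * of_bool (S \<inter> A \<noteq> {}) + best (\<lambda>v. if v \<in> A then r v - m else 0) (S \<inter> V)"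
    (is "_ = _ + best ?r' _")
proof -
  have fin: "finite A" "finite (S \<inter> V)" using assms by auto
  have m_le: "m \<le> r v" if "v \<in> A" for v using that fin by (simp add: m_def)
  have "m \<in> r ` A" unfolding m_def using fin A by (intro Min_in) auto
  then have m0: "0 \<le> m" using A assms by auto
  show ?thesis
  proof (cases "S \<inter> A = {}")
    case True
    then have "r v = 0 \<and> ?r' v = 0" if "v \<in> S \<inter> V" for v using that A by auto
    then have "r ` (S \<inter> V) \<subseteq> {0}" "?r' ` (S \<inter> V) \<subseteq> {0}" by blast+
    then have "insert 0 (r ` (S \<inter> V)) = {0}" "insert 0 (?r' ` (S \<inter> V)) = {0}" by blast+
    then have "best r (S \<inter> V) = 0" "best ?r' (S \<inter> V) = 0"
      by (simp_all only: best_def Max_singleton)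
    with True show ?thesis by simp
  next
    case False
    then obtain a where a: "a \<in> S" "a \<in> A" by auto
    then have aV: "a \<in> S \<inter> V" using A by auto
    have "best r (S \<inter> V) \<le> m + best ?r' (S \<inter> V)"
    proof (rule best_le[OF fin(2)])
      show "0 \<le> m + best ?r' (S \<inter> V)" using m0 best_nonneg[OF fin(2), of ?r'] by simp
      fix v assume v: "v \<in> S \<inter> V"
      then have "?r' v \<le> best ?r' (S \<inter> V)" by (intro best_ge fin)
      then show "r v \<le> m + best ?r' (S \<inter> V)"
        using v A m0 by (auto split: if_splits)
    qed
    moreover have "best ?r' (S \<inter> V) \<le> best r (S \<inter> V) - m"
    proof (rule best_le[OF fin(2)])
      have ra: "m \<le> best r (S \<inter> V)"
        using m_le[OF a(2)] best_ge[OF fin(2) aV, of r] by linarith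
      then show "0 \<le> best r (S \<inter> V) - m" by simp
      fix v assume v: "v \<in> S \<inter> V"
      then have "r v \<le> best r (S \<inter> V)" by (intro best_ge fin)
      then show "?r' v \<le> best r (S \<inter> V) - m" using ra by auto
    qed
    ultimately show ?thesis using False by simp
  qed
qed

lemma integrable_bounded_pmf:
  fixes f :: "'a \<Rightarrow> real"
  assumes "\<And>a. 0 \<le> f a" "\<And>a. f a \<le> b"
  shows "integrable (measure_pmf P) f"
  by (rule measure_pmf.integrable_const_bound[where B = b]) (use assms in auto)

lemma integrable_best:
  assumes "finite V"
  shows "integrable (measure_pmf P) (\<lambda>\<omega>. best r (S \<omega> \<inter> V))"
proof (rule integrable_bounded_pmf)
  fix \<omega>
  show "0 \<le> best r (S \<omega> \<inter> V)" using assms by (intro best_nonneg) simp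
  show "best r (S \<omega> \<inter> V) \<le> (\<Sum>v\<in>V. \<bar>r v\<bar>)"
  proof (rule best_le)
    fix v assume "v \<in> S \<omega> \<inter> V"
    then have "\<bar>r v\<bar> \<le> (\<Sum>v\<in>V. \<bar>r v\<bar>)"
      using assms by (intro member_le_sum) auto
    then show "r v \<le> (\<Sum>v\<in>V. \<bar>r v\<bar>)" by linarith
  qed (use assms in \<open>auto intro: sum_nonneg\<close>)
qed

text \<open>
  Both sides are additive over the layers of \<open>r\<close>, and on a single layer, a multiple of the indicator of
  a set \<open>A\<close>, the claim is the hypothesis about the probability of hitting \<open>A\<close>. The induction removes
  one layer at a time.
\<close>

lemma expected_best_ge:
  fixes r q :: "'a \<Rightarrow> real" and S :: "'w \<Rightarrow> 'a set"
  assumes fin: "finite V" and nonneg: "\<And>v. v \<in> V \<Longrightarrow> 0 \<le> r v"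
    and hit: "\<And>A. A \<subseteq> V \<Longrightarrow> \<kappa> * sum q A \<le> measure_pmf.prob P {\<omega>. S \<omega> \<inter> A \<noteq> {}}"
  shows "\<kappa> * (\<Sum>v\<in>V. r v * q v) \<le> measure_pmf.expectation P (\<lambda>\<omega>. best r (S \<omega> \<inter> V))"
  using nonneg
proof (induction "card {v \<in> V. r v \<noteq> 0}" arbitrary: r rule: less_induct)
  case less
  define A where "A = {v \<in> V. r v \<noteq> 0}"
  have finA: "finite A" using fin by (simp add: A_def)
  show ?case
  proof (cases "A = {}")
    case True
    then have "(\<Sum>v\<in>V. r v * q v) = 0" by (intro sum.neutral) (auto simp: A_def)
    moreover have "0 \<le> measure_pmf.expectation P (\<lambda>\<omega>. best r (S \<omega> \<inter> V))"
      using fin by (intro integral_nonneg_AE AE_pmfI best_nonneg) simp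
    ultimately show ?thesis by simp
  next
    case False
    define m where "m = Min (r ` A)"
    define r' where "r' = (\<lambda>v. if v \<in> A then r v - m else 0)"
    have m_in: "m \<in> r ` A" unfolding m_def using finA False by (intro Min_in) auto
    have m_le: "m \<le> r v" if "v \<in> A" for v using that finA by (simp add: m_def)
    have m0: "0 \<le> m" using m_in less.prems by (auto simp: A_def)
    have IH: "\<kappa> * (\<Sum>v\<in>V. r' v * q v) \<le> measure_pmf.expectation P (\<lambda>\<omega>. best r' (S \<omega> \<inter> V))"
    proof (rule less.hyps)
      obtain a where "a \<in> A" "r a = m" using m_in by auto
      then have "a \<notin> {v \<in> V. r' v \<noteq> 0}" "a \<in> {v \<in> V. r v \<noteq> 0}"
        by (auto simp: r'_def A_def)
      moreover have "{v \<in> V. r' v \<noteq> 0} \<subseteq> {v \<in> V. r v \<noteq> 0}" by (auto simp: r'_def A_def)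
      ultimately show "card {v \<in> V. r' v \<noteq> 0} < card {v \<in> V. r v \<noteq> 0}"
        using fin by (intro psubset_card_mono) auto
      show "0 \<le> r' v" if "v \<in> V" for v using m_le[of v] by (simp add: r'_def)
    qed
    have "(\<Sum>v\<in>V. r v * q v) = (\<Sum>v\<in>V. m * (if v \<in> A then q v else 0) + r' v * q v)"
      by (intro sum.cong refl) (auto simp: r'_def A_def algebra_simps)
    also have "\<dots> = m * sum q A + (\<Sum>v\<in>V. r' v * q v)"
      using fin by (simp add: sum.distrib sum_distrib_left[symmetric] sum.inter_filter[symmetric])
        (simp add: A_def)
    finally have "\<kappa> * (\<Sum>v\<in>V. r v * q v) = m * (\<kappa> * sum q A) + \<kappa> * (\<Sum>v\<in>V. r' v * q v)"
      by (simp add: algebra_simps)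
    also have "\<dots> \<le> m * measure_pmf.prob P {\<omega>. S \<omega> \<inter> A \<noteq> {}}
        + measure_pmf.expectation P (\<lambda>\<omega>. best r' (S \<omega> \<inter> V))"
      using m0 by (intro add_mono mult_left_mono IH hit) (auto simp: A_def)
    also have "measure_pmf.prob P {\<omega>. S \<omega> \<inter> A \<noteq> {}}
        = measure_pmf.expectation P (\<lambda>\<omega>. of_bool (S \<omega> \<inter> A \<noteq> {}))"
    proof -
      have "(\<lambda>\<omega>. of_bool (S \<omega> \<inter> A \<noteq> {}) :: real) = indicator {\<omega>. S \<omega> \<inter> A \<noteq> {}}"
        by (auto simp: indicator_def)
      then show ?thesis by simp
    qed
    also have "m * \<dots> + measure_pmf.expectation P (\<lambda>\<omega>. best r' (S \<omega> \<inter> V))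
        = measure_pmf.expectation P
            (\<lambda>\<omega>. m * of_bool (S \<omega> \<inter> A \<noteq> {}) + best r' (S \<omega> \<inter> V))"
      using integrable_best[OF fin, of P r' S] integrable_bounded_pmf[of "\<lambda>\<omega>. of_bool (S \<omega> \<inter> A \<noteq> {})" 1 P]
      by (subst Bochner_Integration.integral_add) auto
    also have "\<dots> = measure_pmf.expectation P (\<lambda>\<omega>. best r (S \<omega> \<inter> V))"
      using best_peel[OF fin less.prems A_def False] unfolding r'_def m_def by simp
    finally show ?thesis .
  qed
qed

text \<open>
  The concave function \<open>1 - exp (- t)\<close> lies above its chord between \<open>0\<close> and \<open>1\<close>.
\<close>

lemma one_minus_exp_ge:
  fixes t :: real
  assumes "0 \<le> t" "t \<le> 1"
  shows "(1 - 1 / exp 1) * t \<le> 1 - exp (- t)"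
proof -
  have "convex_on UNIV (exp :: real \<Rightarrow> real)" by (rule exp_convex)
  then have "exp ((1 - t) *\<^sub>R 0 + t *\<^sub>R (-1)) \<le> (1 - t) * exp 0 + t * exp (-1 :: real)"
    using assms by (intro convex_onD) auto
  then show ?thesis by (simp add: exp_minus field_simps)
qed

text \<open>
  Here \<open>q v\<close> is the expected number of units from \<open>v\<close> that pick the slot \<open>s\<close>. Since different nodes
  act independently, the probability that none of the nodes in \<open>A\<close> picks \<open>s\<close> is a product of factors
  at most \<open>exp (- q v)\<close>.
\<close>

lemma prob_hit_ge:
  fixes \<rho> \<mu> :: "'v \<Rightarrow> real" and s :: 'a and C :: "'v \<Rightarrow> 'a option pmf"
  assumes fin: "finite V" and A: "A \<subseteq> V"
    and pgf: "\<And>v. v \<in> V \<Longrightarrow> pgf_below_poisson (D v) (\<mu> v)"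
    and q: "\<And>v. v \<in> V \<Longrightarrow> q v = pmf (C v) (Some s) * \<mu> v" "\<And>v. v \<in> V \<Longrightarrow> 0 \<le> q v"
      "sum q V \<le> 1"
  shows "(1 - 1 / exp 1) * sum q A
    \<le> measure_pmf.prob (Pi_pmf V [] (\<lambda>v. arrivals_pmf (D v) (C v)))
         {\<omega>. {v. Some s \<in> set (\<omega> v)} \<inter> A \<noteq> {}}"
proof -
  let ?P = "Pi_pmf V [] (\<lambda>v. arrivals_pmf (D v) (C v))"
  define B where "B = (\<lambda>v. if v \<in> A then {xs. Some s \<notin> set xs} else UNIV)"
  have "measure_pmf.prob ?P {\<omega>. {v. Some s \<in> set (\<omega> v)} \<inter> A = {}}
      = measure_pmf.prob ?P (Pi V B)"
    using A by (intro arg_cong[where f = "measure_pmf.prob ?P"]) (auto simp: B_def Pi_def split: if_splits)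
  also have "\<dots> = (\<Prod>v\<in>V. measure_pmf.prob (arrivals_pmf (D v) (C v)) (B v))"
    using fin by (rule measure_Pi_pmf_Pi)
  also have "\<dots> \<le> (\<Prod>v\<in>V. exp (- (if v \<in> A then q v else 0)))"
  proof (rule prod_mono)
    fix v assume "v \<in> V"
    then show "0 \<le> measure_pmf.prob (arrivals_pmf (D v) (C v)) (B v) \<and>
        measure_pmf.prob (arrivals_pmf (D v) (C v)) (B v) \<le> exp (- (if v \<in> A then q v else 0))"
      using prob_arrivals_avoid[OF pgf, of v "C v" "Some s"] q(1)[of v] by (simp add: B_def)
  qed
  also have "\<dots> = exp (- sum q A)"
    using fin A by (simp add: exp_sum[symmetric] sum_negf sum.inter_restrict[symmetric] Int_absorb1)
  finally have "measure_pmf.prob ?P {\<omega>. {v. Some s \<in> set (\<omega> v)} \<inter> A = {}} \<le> exp (- sum q A)" .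
  moreover have "measure_pmf.prob ?P {\<omega>. {v. Some s \<in> set (\<omega> v)} \<inter> A \<noteq> {}}
      = 1 - measure_pmf.prob ?P {\<omega>. {v. Some s \<in> set (\<omega> v)} \<inter> A = {}}"
    using measure_pmf.prob_compl[of "{\<omega>. {v. Some s \<in> set (\<omega> v)} \<inter> A = {}}" ?P]
    by (simp add: Compl_eq_Diff_UNIV[symmetric] Collect_neg_eq)
  moreover have "(1 - 1 / exp 1) * sum q A \<le> 1 - exp (- sum q A)"
  proof (rule one_minus_exp_ge)
    show "0 \<le> sum q A" using A q by (intro sum_nonneg) auto
    have "sum q A \<le> sum q V" using A q fin by (intro sum_mono2) auto
    then show "sum q A \<le> 1" using q by simp
  qed
  ultimately show ?thesis by linarith
qed

section \<open>Integral and fractional b-matchings\<close>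

definition fractional_b_matchings ::
  "'u set \<Rightarrow> 'v set \<Rightarrow> ('u \<times> 'v) set \<Rightarrow> ('u \<Rightarrow> nat) \<Rightarrow> ('v \<Rightarrow> real) \<Rightarrow> ('u \<times> 'v \<Rightarrow> real) set" where
  "fractional_b_matchings U V E c \<mu> =
     {z. (\<forall>e\<in>E. 0 \<le> z e) \<and> (\<forall>v\<in>V. (\<Sum>e\<in>edgesV E v. z e) \<le> \<mu> v) \<and>
         (\<forall>u\<in>U. (\<Sum>e\<in>edgesU E u. z e) \<le> real (c u))}"

lemma sum_card_fibres:
  fixes g :: "'e \<Rightarrow> real"
  assumes "finite S" "finite F" "\<And>s e. s \<in> S \<Longrightarrow> h s = Some e \<Longrightarrow> e \<in> F"
  shows "(\<Sum>e\<in>F. g e * real (card {s \<in> S. h s = Some e}))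
    = (\<Sum>s\<in>S. case h s of None \<Rightarrow> 0 | Some e \<Rightarrow> g e)"
proof -
  have "(\<Sum>e\<in>F. g e * real (card {s \<in> S. h s = Some e}))
      = (\<Sum>e\<in>F. \<Sum>s\<in>S. if h s = Some e then g e else 0)"
    using assms(1) by (intro sum.cong refl) (simp add: sum.If_cases Int_def)
  also have "\<dots> = (\<Sum>s\<in>S. \<Sum>e\<in>F. if h s = Some e then g e else 0)"
    by (rule sum.swap)
  also have "\<dots> = (\<Sum>s\<in>S. case h s of None \<Rightarrow> 0 | Some e \<Rightarrow> g e)"
    using assms by (intro sum.cong refl) (auto split: option.split)
  finally show ?thesis .
qed

lemma sum_card_fibres_eq_card:
  assumes "finite S" "finite F"
  shows "(\<Sum>e\<in>F. card {s \<in> S. h s = Some e}) = card {s \<in> S. \<exists>e\<in>F. h s = Some e}"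
proof -
  have "{s \<in> S. \<exists>e\<in>F. h s = Some e} = (\<Union>e\<in>F. {s \<in> S. h s = Some e})" by auto
  then show ?thesis using assms by (simp only:) (subst card_UN_disjoint; auto)
qed

locale bipartite_graph =
  fixes U :: "'u set" and V :: "'v set" and E :: "('u \<times> 'v) set" and c :: "'u \<Rightarrow> nat"
  assumes finite_U: "finite U" and finite_V: "finite V" and E_subset: "E \<subseteq> U \<times> V"
    and c_pos: "u \<in> U \<Longrightarrow> 0 < c u"
begin

lemma finite_E: "finite E"
  using finite_subset[OF E_subset] finite_U finite_V by simp

lemma finite_edges: "finite (edgesU E u)" "finite (edgesV E v)"
  using finite_E by (simp_all add: edgesU_def edgesV_def)

lemma sum_edgesV: "(\<Sum>v\<in>V. \<Sum>e\<in>edgesV E v. g e) = sum g E"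
  unfolding edgesV_def using finite_E finite_V E_subset by (intro sum.group) auto

lemma sum_edgesU: "(\<Sum>u\<in>U. \<Sum>e\<in>edgesU E u. g e) = sum g E"
  unfolding edgesU_def using finite_E finite_U E_subset by (intro sum.group) auto

lemma edge_le_capacity:
  assumes "z \<in> b_matchings U V E c \<xi>" "e \<in> E"
  shows "z e \<le> c (fst e)"
proof -
  have "z e \<le> (\<Sum>e\<in>edgesU E (fst e). z e)"
    using assms(2) finite_edges(1) by (intro member_le_sum) (auto simp: edgesU_def)
  also have "\<dots> \<le> c (fst e)" using assms E_subset by (auto simp: b_matchings_def)
  finally show ?thesis .
qed

context
  fixes w :: "'u \<times> 'v \<Rightarrow> real" and x :: "'v \<Rightarrow> real"
begin

lemma finite_matching_values:
  "finite ((\<lambda>z. \<Sum>e\<in>E. (w e + x (snd e)) * real (z e)) ` b_matchings U V E c \<xi>)"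
proof (rule finite_subset)
  let ?F = "Pi\<^sub>E E (\<lambda>e. {..c (fst e)})"
  show "finite ((\<lambda>z. \<Sum>e\<in>E. (w e + x (snd e)) * real (z e)) ` ?F)"
    using finite_E by (intro finite_imageI finite_PiE) auto
  show "(\<lambda>z. \<Sum>e\<in>E. (w e + x (snd e)) * real (z e)) ` b_matchings U V E c \<xi>
      \<subseteq> (\<lambda>z. \<Sum>e\<in>E. (w e + x (snd e)) * real (z e)) ` ?F"
  proof (rule image_subsetI)
    fix z assume z: "z \<in> b_matchings U V E c \<xi>"
    show "(\<Sum>e\<in>E. (w e + x (snd e)) * real (z e))
        \<in> (\<lambda>z. \<Sum>e\<in>E. (w e + x (snd e)) * real (z e)) ` ?F"
    proof (rule image_eqI)
      show "(\<Sum>e\<in>E. (w e + x (snd e)) * real (z e))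
          = (\<Sum>e\<in>E. (w e + x (snd e)) * real (restrict z E e))" by simp
      show "restrict z E \<in> ?F" using edge_le_capacity[OF z] by auto
    qed
  qed
qed

lemma zero_b_matching: "(\<lambda>_. 0) \<in> b_matchings U V E c \<xi>"
  by (simp add: b_matchings_def)

lemma b_matching_value_ge:
  assumes "z \<in> b_matchings U V E c \<xi>"
  shows "(\<Sum>e\<in>E. (w e + x (snd e)) * real (z e)) \<le> b_matching_value U V E w c x \<xi>"
  unfolding b_matching_value_def
  using assms finite_matching_values by (intro cSUP_upper bdd_above_finite)

lemma b_matching_value_attained:
  obtains z where "z \<in> b_matchings U V E c \<xi>"
    "b_matching_value U V E w c x \<xi> = (\<Sum>e\<in>E. (w e + x (snd e)) * real (z e))"
proof -
  let ?A = "(\<lambda>z. \<Sum>e\<in>E. (w e + x (snd e)) * real (z e)) ` b_matchings U V E c \<xi>"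
  have ne: "?A \<noteq> {}" using zero_b_matching by blast
  have "Max ?A \<in> ?A" using finite_matching_values ne by (rule Max_in)
  moreover have "Sup ?A = Max ?A" using finite_matching_values ne by (rule cSup_eq_Max)
  ultimately show ?thesis using that unfolding b_matching_value_def by auto
qed

lemma integrable_b_matching_value:
  "integrable (measure_pmf P) (\<lambda>\<omega>. b_matching_value U V E w c x (\<xi> \<omega>))"
proof (rule integrable_bounded_pmf)
  fix \<omega>
  show "0 \<le> b_matching_value U V E w c x (\<xi> \<omega>)"
    using b_matching_value_ge[OF zero_b_matching] by simp
  obtain z where z: "z \<in> b_matchings U V E c (\<xi> \<omega>)"
    "b_matching_value U V E w c x (\<xi> \<omega>) = (\<Sum>e\<in>E. (w e + x (snd e)) * real (z e))"
    by (rule b_matching_value_attained)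
  have "(\<Sum>e\<in>E. (w e + x (snd e)) * real (z e)) \<le> (\<Sum>e\<in>E. \<bar>w e + x (snd e)\<bar> * real (c (fst e)))"
    using edge_le_capacity[OF z(1)] by (intro sum_mono mult_mono) auto
  with z show "b_matching_value U V E w c x (\<xi> \<omega>)
      \<le> (\<Sum>e\<in>E. \<bar>w e + x (snd e)\<bar> * real (c (fst e)))" by simp
qed

section \<open>The expected optimum is at most a fractional value\<close>

text \<open>
  The witness is the pointwise mean of an optimal b-matching: the constraints and the objective are
  linear, so they pass to the mean.
\<close>

lemma expected_value_le_fractional:
  assumes mean: "\<And>v. v \<in> V \<Longrightarrow> mean_at_most (D v) (\<mu> v)" "\<And>v. v \<in> V \<Longrightarrow> 0 \<le> \<mu> v"
  obtains z where "z \<in> fractional_b_matchings U V E c \<mu>"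
    "measure_pmf.expectation (Pi_pmf V 0 D) (b_matching_value U V E w c x)
       = (\<Sum>e\<in>E. (w e + x (snd e)) * z e)"
proof -
  let ?P = "Pi_pmf V 0 D"
  have "\<forall>\<xi>. \<exists>z. z \<in> b_matchings U V E c \<xi> \<and>
      b_matching_value U V E w c x \<xi> = (\<Sum>e\<in>E. (w e + x (snd e)) * real (z e))"
    using b_matching_value_attained by metis
  then obtain zopt where zopt: "\<And>\<xi>. zopt \<xi> \<in> b_matchings U V E c \<xi>"
    and opt_eq: "\<And>\<xi>. b_matching_value U V E w c x \<xi> = (\<Sum>e\<in>E. (w e + x (snd e)) * real (zopt \<xi> e))"
    by metis
  have int: "integrable (measure_pmf ?P) (\<lambda>\<xi>. real (zopt \<xi> e))" if "e \<in> E" for e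
    using edge_le_capacity[OF zopt that]
    by (intro integrable_bounded_pmf[where b = "real (c (fst e))"]) auto
  define z where "z = (\<lambda>e. measure_pmf.expectation ?P (\<lambda>\<xi>. real (zopt \<xi> e)))"
  have sum_z: "(\<Sum>e\<in>F. z e) = measure_pmf.expectation ?P (\<lambda>\<xi>. real (\<Sum>e\<in>F. zopt \<xi> e))"
    if "F \<subseteq> E" for F
    using int that unfolding z_def of_nat_sum
    by (subst Bochner_Integration.integral_sum) auto
  have intF: "integrable (measure_pmf ?P) (\<lambda>\<xi>. real (\<Sum>e\<in>F. zopt \<xi> e))" if "F \<subseteq> E" for F
    using int that unfolding of_nat_sum by (intro Bochner_Integration.integrable_sum) auto
  have "z \<in> fractional_b_matchings U V E c \<mu>"
    unfolding fractional_b_matchings_def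
  proof (intro CollectI conjI ballI)
    show "0 \<le> z e" for e by (simp add: z_def)
    fix v assume v: "v \<in> V"
    have sub: "edgesV E v \<subseteq> E" by (auto simp: edgesV_def)
    have comp: "map_pmf (\<lambda>\<xi>. \<xi> v) ?P = D v"
      using v finite_V by (simp add: Pi_pmf_component)
    have le: "(\<integral>\<^sup>+\<xi>. ennreal (real (\<xi> v)) \<partial>measure_pmf ?P) \<le> ennreal (\<mu> v)"
      using mean(1)[OF v] unfolding mean_at_most_def comp[symmetric] by simp
    have "ennreal (\<Sum>e\<in>edgesV E v. z e)
        = (\<integral>\<^sup>+\<xi>. ennreal (real (\<Sum>e\<in>edgesV E v. zopt \<xi> e)) \<partial>measure_pmf ?P)"
      unfolding sum_z[OF sub]
      by (rule nn_integral_eq_integral[symmetric, OF intF[OF sub]]) (simp del: of_nat_sum)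
    also have "\<dots> \<le> (\<integral>\<^sup>+\<xi>. ennreal (real (\<xi> v)) \<partial>measure_pmf ?P)"
      using zopt v by (intro nn_integral_mono ennreal_leI) (auto simp: b_matchings_def simp del: of_nat_sum)
    also note le
    finally show "(\<Sum>e\<in>edgesV E v. z e) \<le> \<mu> v"
      using mean(2)[OF v] by simp
  next
    fix u assume u: "u \<in> U"
    have sub: "edgesU E u \<subseteq> E" by (auto simp: edgesU_def)
    have "(\<Sum>e\<in>edgesU E u. z e) \<le> measure_pmf.expectation ?P (\<lambda>_. real (c u))"
      unfolding sum_z[OF sub]
      using zopt u by (intro integral_mono intF[OF sub]) (auto simp: b_matchings_def simp del: of_nat_sum)
    then show "(\<Sum>e\<in>edgesU E u. z e) \<le> real (c u)" by simp
  qed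
  moreover have "measure_pmf.expectation ?P (b_matching_value U V E w c x)
      = (\<Sum>e\<in>E. (w e + x (snd e)) * z e)"
  proof -
    have "b_matching_value U V E w c x = (\<lambda>\<xi>. \<Sum>e\<in>E. (w e + x (snd e)) * real (zopt \<xi> e))"
      using opt_eq by blast
    then show ?thesis
      using int by (simp add: z_def Bochner_Integration.integral_sum)
  qed
  ultimately show ?thesis by (rule that)
qed

section \<open>Random rounding of a fractional b-matching\<close>

definition slots :: "('u \<times> nat) set" where
  "slots = (SIGMA u:U. {..<c u})"

text \<open>
  Edges of negative weight are never used, hence the truncation at \<open>0\<close>.
\<close>

definition reward :: "'u \<Rightarrow> 'v \<Rightarrow> real" where
  "reward u v = (if (u, v) \<in> E then max 0 (w (u, v) + x v) else 0)"

lemma finite_slots: "finite slots"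
  using finite_U by (simp add: slots_def)

text \<open>
  Spreading a quantity evenly over the \<open>c u\<close> slots of each \<open>u\<close> does not change its total.
\<close>

lemma sum_slots_div:
  assumes "\<And>u. u \<in> U \<Longrightarrow> g u = real (c u) * h u"
  shows "(\<Sum>s\<in>slots. h (fst s)) = (\<Sum>u\<in>U. g u :: real)"
proof -
  have "(\<Sum>s\<in>slots. h (fst s)) = (\<Sum>u\<in>U. \<Sum>j<c u. h u)"
    unfolding slots_def using finite_U by (subst sum.Sigma) (auto intro!: sum.cong)
  then show ?thesis using assms by simp
qed

text \<open>
  Letting every slot keep its best arrival yields a feasible b-matching: a slot keeps at most one unit,
  and distinct slots keep distinct units because each unit picks at most one slot.
\<close>

lemma b_matching_value_ge_slots:
  fixes \<omega> :: "'v \<Rightarrow> ('u \<times> nat) option list"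
  shows "(\<Sum>s\<in>slots. best (reward (fst s)) ({v. Some s \<in> set (\<omega> v)} \<inter> V))
    \<le> b_matching_value U V E w c x (length \<circ> \<omega>)"
proof -
  \<comment> \<open>the edge along which slot \<open>s\<close> is served, if any\<close>
  have "\<exists>k. (\<forall>e. k = Some e \<longrightarrow> e \<in> E \<and> fst e = fst s \<and> Some s \<in> set (\<omega> (snd e))) \<and>
      best (reward (fst s)) ({v. Some s \<in> set (\<omega> v)} \<inter> V)
        = (case k of None \<Rightarrow> 0 | Some e \<Rightarrow> w e + x (snd e))" for s
  proof -
    let ?S = "{v. Some s \<in> set (\<omega> v)} \<inter> V"
    have fin: "finite ?S" using finite_V by simp
    show ?thesis
    proof (cases "best (reward (fst s)) ?S = 0")
      case True
      then show ?thesis by (intro exI[of _ None]) simp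
    next
      case False
      with fin obtain v where v: "v \<in> ?S" "best (reward (fst s)) ?S = reward (fst s) v"
        by (metis best_cases)
      with False show ?thesis
        by (intro exI[of _ "Some (fst s, v)"]) (auto simp: reward_def max_def split: if_splits)
    qed
  qed
  then obtain k where
    k: "\<And>s e. k s = Some e \<Longrightarrow> e \<in> E \<and> fst e = fst s \<and> Some s \<in> set (\<omega> (snd e))"
    and best: "\<And>s. best (reward (fst s)) ({v. Some s \<in> set (\<omega> v)} \<inter> V)
        = (case k s of None \<Rightarrow> 0 | Some e \<Rightarrow> w e + x (snd e))"
    by metis
  define z where "z = (\<lambda>e. card {s \<in> slots. k s = Some e})"
  have "z \<in> b_matchings U V E c (length \<circ> \<omega>)"
    unfolding b_matchings_def
  proof (intro CollectI conjI ballI)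
    fix v
    have "(\<Sum>e\<in>edgesV E v. z e) = card {s \<in> slots. \<exists>e\<in>edgesV E v. k s = Some e}"
      unfolding z_def using finite_slots finite_edges by (intro sum_card_fibres_eq_card)
    also have "\<dots> \<le> card (the ` set (\<omega> v))"
    proof (rule card_mono)
      show "{s \<in> slots. \<exists>e\<in>edgesV E v. k s = Some e} \<subseteq> the ` set (\<omega> v)"
      proof
        fix s assume "s \<in> {s \<in> slots. \<exists>e\<in>edgesV E v. k s = Some e}"
        then obtain e where "e \<in> edgesV E v" "k s = Some e" by blast
        then have "Some s \<in> set (\<omega> v)" using k[of s e] by (simp add: edgesV_def)
        then have "the (Some s) \<in> the ` set (\<omega> v)" by (rule imageI)
        then show "s \<in> the ` set (\<omega> v)" by simp
      qed
    qed simp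
    also have "\<dots> \<le> length (\<omega> v)"
      using card_image_le[of "set (\<omega> v)" the] card_length[of "\<omega> v"] by simp
    finally show "(\<Sum>e\<in>edgesV E v. z e) \<le> (length \<circ> \<omega>) v" by simp
  next
    fix u
    have "(\<Sum>e\<in>edgesU E u. z e) = card {s \<in> slots. \<exists>e\<in>edgesU E u. k s = Some e}"
      unfolding z_def using finite_slots finite_edges by (intro sum_card_fibres_eq_card)
    also have "\<dots> \<le> card ({u} \<times> {..<c u})"
      by (intro card_mono) (auto simp: edgesU_def slots_def dest: k)
    finally show "(\<Sum>e\<in>edgesU E u. z e) \<le> c u" by simp
  qed
  then have "(\<Sum>e\<in>E. (w e + x (snd e)) * real (z e)) \<le> b_matching_value U V E w c x (length \<circ> \<omega>)"
    by (rule b_matching_value_ge)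
  moreover have "(\<Sum>e\<in>E. (w e + x (snd e)) * real (z e))
      = (\<Sum>s\<in>slots. case k s of None \<Rightarrow> 0 | Some e \<Rightarrow> w e + x (snd e))"
    unfolding z_def using finite_slots finite_E k by (intro sum_card_fibres) auto
  ultimately show ?thesis using best by simp
qed

text \<open>
  A unit of demand at \<open>v\<close> picks each slot of \<open>u\<close> with probability \<open>z (u, v) / (\<mu> v * c u)\<close>. The
  constraint at \<open>v\<close> makes these subprobabilities; the constraint at \<open>u\<close> bounds the expected number of
  arrivals at a slot by \<open>1\<close>, which is where \<open>prob_hit_ge\<close> needs it.
\<close>

lemma expected_value_ge_fractional:
  assumes pgf: "\<And>v. v \<in> V \<Longrightarrow> pgf_below_poisson (D v) (\<mu> v)"
    and z: "z \<in> fractional_b_matchings U V E c \<mu>"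
  shows "(1 - 1 / exp 1) * (\<Sum>e\<in>E. (w e + x (snd e)) * z e)
    \<le> measure_pmf.expectation (Pi_pmf V 0 D) (b_matching_value U V E w c x)"
proof -
  let ?\<kappa> = "1 - 1 / exp 1 :: real"
  define \<zeta> where "\<zeta> = (\<lambda>u v. if (u, v) \<in> E then z (u, v) else 0)"
  have \<zeta>_nonneg: "0 \<le> \<zeta> u v" for u v using z by (auto simp: \<zeta>_def fractional_b_matchings_def)
  have \<zeta>_V: "(\<Sum>u\<in>U. \<zeta> u v) \<le> \<mu> v" if "v \<in> V" for v
  proof -
    have "(\<Sum>u\<in>U. \<zeta> u v) = (\<Sum>u | u \<in> U \<and> (u, v) \<in> E. z (u, v))"
      unfolding \<zeta>_def using finite_U by (simp add: sum.inter_filter)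
    also have "\<dots> = (\<Sum>e\<in>edgesV E v. z e)"
      using E_subset
      by (intro sum.reindex_bij_witness[of _ fst "\<lambda>u. (u, v)"]) (auto simp: edgesV_def)
    also have "\<dots> \<le> \<mu> v" using z that by (auto simp: fractional_b_matchings_def)
    finally show ?thesis .
  qed
  have \<zeta>_U: "(\<Sum>v\<in>V. \<zeta> u v) \<le> real (c u)" if "u \<in> U" for u
  proof -
    have "(\<Sum>v\<in>V. \<zeta> u v) = (\<Sum>v | v \<in> V \<and> (u, v) \<in> E. z (u, v))"
      unfolding \<zeta>_def using finite_V by (simp add: sum.inter_filter)
    also have "\<dots> = (\<Sum>e\<in>edgesU E u. z e)"
      using E_subset
      by (intro sum.reindex_bij_witness[of _ snd "\<lambda>v. (u, v)"]) (auto simp: edgesU_def)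
    also have "\<dots> \<le> real (c u)" using z that by (auto simp: fractional_b_matchings_def)
    finally show ?thesis .
  qed
  have \<mu>_nonneg: "0 \<le> \<mu> v" if "v \<in> V" for v
    using \<zeta>_V[OF that] \<zeta>_nonneg sum_nonneg[of U "\<lambda>u. \<zeta> u v"] by force
  have "\<exists>C. \<forall>s\<in>slots. pmf C (Some s) = \<zeta> (fst s) v / (\<mu> v * real (c (fst s)))" if v: "v \<in> V" for v
  proof (rule exists_option_pmf[OF finite_slots])
    show "0 \<le> \<zeta> (fst s) v / (\<mu> v * real (c (fst s)))" for s
      using \<zeta>_nonneg \<mu>_nonneg[OF v] by simp
    have "(\<Sum>s\<in>slots. \<zeta> (fst s) v / (\<mu> v * real (c (fst s)))) = (\<Sum>u\<in>U. \<zeta> u v / \<mu> v)"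
      using c_pos by (intro sum_slots_div) (auto simp: field_simps)
    also have "\<dots> \<le> 1"
      using \<zeta>_V[OF v] \<mu>_nonneg[OF v]
      by (cases "\<mu> v = 0") (auto simp: sum_divide_distrib[symmetric] divide_le_eq_1)
    finally show "(\<Sum>s\<in>slots. \<zeta> (fst s) v / (\<mu> v * real (c (fst s)))) \<le> 1" .
  qed
  then obtain C where
    C: "\<And>v s. v \<in> V \<Longrightarrow> s \<in> slots \<Longrightarrow> pmf (C v) (Some s) = \<zeta> (fst s) v / (\<mu> v * real (c (fst s)))"
    by metis
  let ?P = "Pi_pmf V [] (\<lambda>v. arrivals_pmf (D v) (C v))"
  let ?S = "\<lambda>s \<omega>. {v. Some s \<in> set (\<omega> v)}"
  have slot: "?\<kappa> * (\<Sum>v\<in>V. reward (fst s) v * (\<zeta> (fst s) v / real (c (fst s))))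
      \<le> measure_pmf.expectation ?P (\<lambda>\<omega>. best (reward (fst s)) (?S s \<omega> \<inter> V))" if s: "s \<in> slots" for s
  proof (rule expected_best_ge[OF finite_V])
    show "0 \<le> reward (fst s) v" for v by (simp add: reward_def)
    fix A assume A: "A \<subseteq> V"
    have u: "fst s \<in> U" using s by (auto simp: slots_def)
    show "?\<kappa> * (\<Sum>v\<in>A. \<zeta> (fst s) v / real (c (fst s))) \<le> measure_pmf.prob ?P {\<omega>. ?S s \<omega> \<inter> A \<noteq> {}}"
    proof (rule prob_hit_ge[OF finite_V A pgf])
      fix v assume v: "v \<in> V"
      \<comment> \<open>if \<open>\<mu> v = 0\<close>, the probabilities are quotients by \<open>0\<close> and hence \<open>0\<close>, as they should be\<close>
      have "\<zeta> (fst s) v = 0" if "\<mu> v = 0"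
        using \<zeta>_V[OF v] that \<zeta>_nonneg u finite_U member_le_sum[of "fst s" U "\<lambda>u. \<zeta> u v"]
        by (metis order_antisym order_trans)
      then show "\<zeta> (fst s) v / real (c (fst s)) = pmf (C v) (Some s) * \<mu> v"
        using C[OF v s] by (cases "\<mu> v = 0") auto
      show "0 \<le> \<zeta> (fst s) v / real (c (fst s))" using \<zeta>_nonneg by simp
    next
      show "(\<Sum>v\<in>V. \<zeta> (fst s) v / real (c (fst s))) \<le> 1"
        using \<zeta>_U[OF u] c_pos[OF u] by (simp add: sum_divide_distrib[symmetric])
    qed
  qed
  have "(\<Sum>e\<in>E. (w e + x (snd e)) * z e) \<le> (\<Sum>e\<in>E. reward (fst e) (snd e) * \<zeta> (fst e) (snd e))"
    using z by (intro sum_mono) (auto simp: reward_def \<zeta>_def fractional_b_matchings_def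
        intro!: mult_right_mono)
  also have "\<dots> = (\<Sum>e\<in>U \<times> V. reward (fst e) (snd e) * \<zeta> (fst e) (snd e))"
    using finite_U finite_V E_subset by (intro sum.mono_neutral_left) (auto simp: reward_def)
  also have "\<dots> = (\<Sum>u\<in>U. \<Sum>v\<in>V. reward u v * \<zeta> u v)"
    by (simp add: sum.cartesian_product case_prod_beta)
  also have "\<dots> = (\<Sum>s\<in>slots. \<Sum>v\<in>V. reward (fst s) v * (\<zeta> (fst s) v / real (c (fst s))))"
    using c_pos by (intro sum_slots_div[symmetric]) (auto simp: sum_distrib_left intro!: sum.cong)
  finally have "?\<kappa> * (\<Sum>e\<in>E. (w e + x (snd e)) * z e)
      \<le> ?\<kappa> * (\<Sum>s\<in>slots. \<Sum>v\<in>V. reward (fst s) v * (\<zeta> (fst s) v / real (c (fst s))))"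
    by (intro mult_left_mono) auto
  also have "\<dots> \<le> (\<Sum>s\<in>slots. measure_pmf.expectation ?P (\<lambda>\<omega>. best (reward (fst s)) (?S s \<omega> \<inter> V)))"
    unfolding sum_distrib_left[of ?\<kappa> _ slots] by (intro sum_mono slot)
  also have "\<dots> = measure_pmf.expectation ?P (\<lambda>\<omega>. \<Sum>s\<in>slots. best (reward (fst s)) (?S s \<omega> \<inter> V))"
    using integrable_best[OF finite_V] by (intro Bochner_Integration.integral_sum[symmetric]) auto
  also have "\<dots> \<le> measure_pmf.expectation ?P (\<lambda>\<omega>. b_matching_value U V E w c x (length \<circ> \<omega>))"
    using integrable_best[OF finite_V]
    by (intro integral_mono integrable_b_matching_value b_matching_value_ge_slots
        Bochner_Integration.integrable_sum) auto
  also have "\<dots> = measure_pmf.expectation (map_pmf (\<lambda>\<omega>. length \<circ> \<omega>) ?P) (b_matching_value U V E w c x)"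
    by simp
  also have "map_pmf (\<lambda>\<omega>. length \<circ> \<omega>) ?P = Pi_pmf V 0 D"
    using Pi_pmf_map[OF finite_V, of length "[]" 0 "\<lambda>v. arrivals_pmf (D v) (C v)"]
    by (simp add: map_length_arrivals_pmf)
  finally show ?thesis .
qed

end

end

section \<open>Raising prices\<close>

text \<open>
  The acceptance function is continuous and reaches values arbitrarily close to \<open>0\<close>, or \<open>0\<close> itself, at
  high prices.
\<close>

lemma acceptance_ivt:
  assumes acc: "acceptance_function X Z p" and X: "is_interval X" and x: "x \<in> X"
    and y: "0 < y" "y \<le> p x"
  obtains x' where "x' \<in> X" "x \<le> x'" "p x' = y"
proof -
  obtain b where b: "b \<in> X" "x \<le> b" "p b \<le> y"
  proof (cases "bdd_above X")
    case True
    then obtain m where "m \<in> X" "\<forall>x\<in>X. x \<le> m" "p m = 0"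
      using acc by (auto simp: acceptance_function_def)
    with x y show ?thesis by (intro that[of m]) auto
  next
    case False
    then have "(p \<longlongrightarrow> 0) at_top" using acc by (simp add: acceptance_function_def)
    then have "eventually (\<lambda>t. p t < y) at_top" using y(1) by (rule order_tendstoD)
    then obtain t where t: "\<And>s. t \<le> s \<Longrightarrow> p s < y" by (auto simp: eventually_at_top_linorder)
    obtain s where s: "s \<in> X" "max t x < s"
      using False by (meson bdd_above.I not_less)
    then show ?thesis using t[of s] by (intro that[of s]) auto
  qed
  have sub: "{x..b} \<subseteq> X" using mem_is_interval_1_I[OF X x b(1)] by auto
  have "continuous_on X p"
    using acc by (auto simp: acceptance_function_def intro: differentiable_imp_continuous_on)
  then have "continuous_on {x..b} p" using sub by (rule continuous_on_subset)
  then obtain x' where "x \<le> x'" "x' \<le> b" "p x' = y"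
    using IVT2'[of p b y x] b y by blast
  with sub show ?thesis by (intro that[of x']) auto
qed

locale priced_graph = bipartite_graph U V E c
  for U :: "'u set" and V :: "'v set" and E and c +
  fixes n :: "'v \<Rightarrow> nat" and X Z :: "'v \<Rightarrow> real set" and p :: "'v \<Rightarrow> real \<Rightarrow> real"
    and w :: "'u \<times> 'v \<Rightarrow> real"
  assumes n_pos: "v \<in> V \<Longrightarrow> 0 < n v"
    and interval: "v \<in> V \<Longrightarrow> is_interval (X v)"
    and Z_unit: "v \<in> V \<Longrightarrow> Z v \<subseteq> {0..1}"
    and edgesV_nonempty: "v \<in> V \<Longrightarrow> edgesV E v \<noteq> {}"
    and acceptance: "v \<in> V \<Longrightarrow> acceptance_function (X v) (Z v) (p v)"
begin

lemma demands_eq_image: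
  assumes "v \<in> V"
  shows "(\<lambda>q. real (n v) * q) ` Z v = mean_demand n p v ` X v"
proof -
  have "Z v = p v ` X v"
    using acceptance[OF assms] by (simp add: acceptance_function_def bij_betw_def)
  then show ?thesis by (auto simp: mean_demand_def image_iff)
qed

lemma mean_demand_inv_mean_demand:
  assumes "v \<in> V" "x \<in> X v"
  shows "mean_demand_inv n X p v (mean_demand n p v x) = x"
proof -
  have "inj_on (p v) (X v)"
    using acceptance[OF assms(1)] by (simp add: acceptance_function_def bij_betw_def)
  then have "inj_on (mean_demand n p v) (X v)"
    using n_pos[OF assms(1)] by (simp add: mean_demand_def inj_on_def)
  then show ?thesis using assms(2) by (simp add: mean_demand_inv_def inv_into_f_f)
qed

lemma p_unit:
  assumes "v \<in> V" "x \<in> X v"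
  shows "p v x \<in> {0..1}"
proof -
  have "p v x \<in> Z v"
    using acceptance[OF assms(1)] assms(2) by (auto simp: acceptance_function_def bij_betw_def)
  with Z_unit[OF assms(1)] show ?thesis by blast
qed

lemma mean_demand_nonneg: "v \<in> V \<Longrightarrow> x \<in> X v \<Longrightarrow> 0 \<le> mean_demand n p v x"
  using p_unit by (simp add: mean_demand_def)

lemma mean_demand_le: "v \<in> V \<Longrightarrow> x \<in> X v \<Longrightarrow> mean_demand n p v x \<le> real (n v)"
  using p_unit by (simp add: mean_demand_def mult_left_le)

text \<open>
  The value \<open>0\<close> is a mean demand only if some price attains it. This is why \<open>a\<close> has to be positive
  unless \<open>x\<close> itself has mean demand \<open>0\<close>.
\<close>

lemma higher_price:
  assumes v: "v \<in> V" and x: "x \<in> X v" and a: "0 \<le> a" "a \<le> mean_demand n p v x"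
    and pos: "0 < mean_demand n p v x \<Longrightarrow> 0 < a"
  shows "a \<in> (\<lambda>q. real (n v) * q) ` Z v" and "x \<le> mean_demand_inv n X p v a"
proof -
  have "\<exists>x'\<in>X v. x \<le> x' \<and> mean_demand n p v x' = a"
  proof (cases "mean_demand n p v x = 0")
    case True
    with a x show ?thesis by (intro bexI[of _ x]) auto
  next
    case False
    then have "0 < a" using pos a by linarith
    then obtain x' where "x' \<in> X v" "x \<le> x'" "p v x' = a / real (n v)"
      using acceptance_ivt[OF acceptance[OF v] interval[OF v] x, of "a / real (n v)"] a n_pos[OF v]
      by (auto simp: mean_demand_def field_simps)
    then show ?thesis using n_pos[OF v] by (intro bexI[of _ x']) (auto simp: mean_demand_def)
  qed
  then obtain x' where x': "x' \<in> X v" "x \<le> x'" "mean_demand n p v x' = a" by blast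
  then show "a \<in> (\<lambda>q. real (n v) * q) ` Z v" using demands_eq_image[OF v] by blast
  show "x \<le> mean_demand_inv n X p v a" using mean_demand_inv_mean_demand[OF v x'(1)] x' by simp
qed

section \<open>Fractional b-matchings and the flow problem\<close>

lemma total_flow_le_capacity:
  assumes "\<And>v. v \<in> V \<Longrightarrow> (\<Sum>e\<in>edgesV E v. z e) \<in> (\<lambda>q. real (n v) * q) ` Z v"
    and "\<And>u. u \<in> U \<Longrightarrow> (\<Sum>e\<in>edgesU E u. z e) \<le> real (c u)"
  shows "sum z E \<le> flow_capacity U V c n Z"
proof -
  have "(\<Sum>e\<in>edgesV E v. z e) \<le> Sup ((\<lambda>q. real (n v) * q) ` Z v)" if v: "v \<in> V" for v
  proof (rule cSup_upper[OF assms(1)[OF v]])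
    show "bdd_above ((\<lambda>q. real (n v) * q) ` Z v)"
      using Z_unit[OF v] by (intro bdd_aboveI[of _ "real (n v)"]) (auto intro!: mult_left_le)
  qed
  then have "sum z E \<le> (\<Sum>v\<in>V. Sup ((\<lambda>q. real (n v) * q) ` Z v))"
    unfolding sum_edgesV[symmetric] by (rule sum_mono)
  moreover have "sum z E \<le> (\<Sum>u\<in>U. real (c u))"
    unfolding sum_edgesU[symmetric] using assms(2) by (rule sum_mono)
  ultimately show ?thesis by (simp add: flow_capacity_def)
qed

lemma FP_objective_eq:
  assumes "\<And>v. v \<in> V \<Longrightarrow> zt v = (\<Sum>e\<in>edgesV E v. z e)"
  shows "FP_objective V E w n X p z zt
    = - (\<Sum>e\<in>E. (w e + mean_demand_inv n X p (snd e) (zt (snd e))) * z e)"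
proof -
  have "(\<Sum>v\<in>V. - mean_demand_inv n X p v (zt v) * zt v)
      = (\<Sum>v\<in>V. \<Sum>e\<in>edgesV E v. - mean_demand_inv n X p (snd e) (zt (snd e)) * z e)"
    using assms by (intro sum.cong refl) (simp add: sum_distrib_left edgesV_def)
  also have "\<dots> = (\<Sum>e\<in>E. - mean_demand_inv n X p (snd e) (zt (snd e)) * z e)"
    by (rule sum_edgesV)
  finally show ?thesis
    by (simp add: FP_objective_def sum.distrib sum_negf algebra_simps)
qed

text \<open>
  Repricing every \<open>v\<close> so that its mean demand equals its flow makes \<open>y\<close> feasible in the flow problem,
  the rest of the flow going along \<open>(s,t)\<close>. No price decreases, and \<open>y \<ge> 0\<close>, so the value does not
  decrease either.
\<close>

lemma FP_optimal_ge_supported: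
  assumes opt: "FP_optimal U V E w c n X Z p z zs zt zst"
    and x: "\<And>v. v \<in> V \<Longrightarrow> x v \<in> X v"
    and y: "y \<in> fractional_b_matchings U V E c (\<lambda>v. mean_demand n p v (x v))"
    and pos: "\<And>v. v \<in> V \<Longrightarrow> 0 < mean_demand n p v (x v) \<Longrightarrow> 0 < (\<Sum>e\<in>edgesV E v. y e)"
  shows "(\<Sum>e\<in>E. (w e + x (snd e)) * y e) \<le> - FP_objective V E w n X p z zt"
proof -
  define yt where "yt = (\<lambda>v. \<Sum>e\<in>edgesV E v. y e)"
  have y_nonneg: "\<And>e. e \<in> E \<Longrightarrow> 0 \<le> y e"
    and y_le: "\<And>v. v \<in> V \<Longrightarrow> yt v \<le> mean_demand n p v (x v)"
    "\<And>u. u \<in> U \<Longrightarrow> (\<Sum>e\<in>edgesU E u. y e) \<le> real (c u)"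
    using y by (auto simp: fractional_b_matchings_def yt_def)
  have sums_nonneg: "0 \<le> yt v" "0 \<le> (\<Sum>e\<in>edgesU E u. y e)" for u v
    using y_nonneg by (auto simp: yt_def edgesV_def edgesU_def intro!: sum_nonneg)
  have price: "yt v \<in> (\<lambda>q. real (n v) * q) ` Z v" "x v \<le> mean_demand_inv n X p v (yt v)"
    if "v \<in> V" for v
    using higher_price[OF that x[OF that] sums_nonneg(1) y_le(1)[OF that]] pos[OF that]
    unfolding yt_def by blast+
  have total: "sum y E \<le> flow_capacity U V c n Z"
    using price(1) y_le(2) unfolding yt_def by (rule total_flow_le_capacity)
  have "FP_feasible U V E c n Z y (\<lambda>u. \<Sum>e\<in>edgesU E u. y e) yt (flow_capacity U V c n Z - sum y E)"
    unfolding FP_feasible_def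
    using y_nonneg y_le(2) sums_nonneg total price(1) sum_edgesV[of y] sum_edgesU[of y] sum_nonneg[of E y]
    by (simp add: yt_def)
  then have "FP_objective V E w n X p z zt \<le> FP_objective V E w n X p y yt"
    using opt unfolding FP_optimal_def by blast
  also have "\<dots> = - (\<Sum>e\<in>E. (w e + mean_demand_inv n X p (snd e) (yt (snd e))) * y e)"
    by (rule FP_objective_eq) (simp add: yt_def)
  also have "\<dots> \<le> - (\<Sum>e\<in>E. (w e + x (snd e)) * y e)"
    using price(2) y_nonneg E_subset
    by (intro le_imp_neg_le sum_mono mult_right_mono add_left_mono) auto
  finally show ?thesis by linarith
qed

text \<open>
  A flow proportional to the mean demands, scaled down so far that all capacities hold.
\<close>

lemma exists_supported_fractional:
  assumes x: "\<And>v. v \<in> V \<Longrightarrow> x v \<in> X v"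
  obtains y where "y \<in> fractional_b_matchings U V E c (\<lambda>v. mean_demand n p v (x v))"
    "\<And>v. v \<in> V \<Longrightarrow> 0 < mean_demand n p v (x v) \<Longrightarrow> 0 < (\<Sum>e\<in>edgesV E v. y e)"
proof -
  let ?\<mu> = "\<lambda>v. mean_demand n p v (x v)"
  define N where "N = (1 + real (card E)) * (1 + real (\<Sum>v\<in>V. n v))"
  define y where "y = (\<lambda>e :: 'u \<times> 'v. ?\<mu> (snd e) / N)"
  have N: "0 < N" "real (card E) \<le> N" "real (card E) * real (\<Sum>v\<in>V. n v) \<le> N"
    by (auto simp: N_def algebra_simps add_pos_nonneg simp del: of_nat_sum)
  have \<mu>: "0 \<le> ?\<mu> v" "?\<mu> v \<le> real (\<Sum>v\<in>V. n v)" if "v \<in> V" for v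
  proof -
    show "0 \<le> ?\<mu> v" using mean_demand_nonneg[OF that x[OF that]] .
    have "n v \<le> (\<Sum>v\<in>V. n v)" using that finite_V by (intro member_le_sum) auto
    then show "?\<mu> v \<le> real (\<Sum>v\<in>V. n v)"
      using mean_demand_le[OF that x[OF that]] by (simp del: of_nat_sum)
  qed
  have card_le: "card (edgesV E v) \<le> card E" "card (edgesU E u) \<le> card E" for u v
    using finite_E by (auto simp: edgesV_def edgesU_def intro!: card_mono)
  have sumV: "(\<Sum>e\<in>edgesV E v. y e) = real (card (edgesV E v)) * ?\<mu> v / N" for v
    by (simp add: y_def edgesV_def)
  have "y \<in> fractional_b_matchings U V E c ?\<mu>"
    unfolding fractional_b_matchings_def
  proof (intro CollectI conjI ballI)
    fix e assume "e \<in> E"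
    then show "0 \<le> y e" using E_subset \<mu>(1) N by (auto simp: y_def)
  next
    fix v assume v: "v \<in> V"
    have "real (card (edgesV E v)) * ?\<mu> v \<le> N * ?\<mu> v"
      using card_le(1)[of v] N \<mu>(1)[OF v] by (intro mult_right_mono) linarith+
    then show "(\<Sum>e\<in>edgesV E v. y e) \<le> ?\<mu> v" using N by (simp add: sumV field_simps)
  next
    fix u assume u: "u \<in> U"
    have "(\<Sum>e\<in>edgesU E u. y e) \<le> (\<Sum>e\<in>edgesU E u. real (\<Sum>v\<in>V. n v) / N)"
      using E_subset N(1) \<mu>(2) by (intro sum_mono) (auto simp: y_def edgesU_def intro!: divide_right_mono)
    also have "\<dots> = real (card (edgesU E u)) * real (\<Sum>v\<in>V. n v) / N"
      by simp
    also have "\<dots> \<le> real (card E) * real (\<Sum>v\<in>V. n v) / N"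
      using card_le(2) N by (intro divide_right_mono mult_right_mono) (auto intro: sum_nonneg)
    also have "\<dots> \<le> 1" using N by simp
    also have "1 \<le> real (c u)" using c_pos[OF u] by simp
    finally show "(\<Sum>e\<in>edgesU E u. y e) \<le> real (c u)" .
  qed
  moreover have "0 < (\<Sum>e\<in>edgesV E v. y e)" if "v \<in> V" "0 < ?\<mu> v" for v
    using that edgesV_nonempty[OF that(1)] finite_edges(2)[of v] N
    by (simp add: sumV card_gt_0_iff)
  ultimately show ?thesis by (rule that)
qed

lemma fractional_b_matchings_convex:
  assumes y: "y \<in> fractional_b_matchings U V E c \<mu>" "y' \<in> fractional_b_matchings U V E c \<mu>"
    and t: "0 \<le> t" "t \<le> 1"
  shows "(\<lambda>e. (1 - t) * y e + t * y' e) \<in> fractional_b_matchings U V E c \<mu>"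
proof -
  have *: "(1 - t) * a + t * a' \<le> b" if "a \<le> b" "a' \<le> b" for a a' b :: real
    using convex_bound_le[of a b a' "1 - t" t] that t by simp
  show ?thesis
    using y t
    by (auto simp: fractional_b_matchings_def sum.distrib sum_distrib_left[symmetric] intro!: *)
qed

text \<open>
  If \<open>y\<close> vanishes at some \<open>v\<close>, there may be no price with mean demand \<open>0\<close>. Mixing in a little of a
  b-matching that is positive wherever there is demand avoids this, and the share of the mixture then
  tends to \<open>0\<close>.
\<close>

lemma FP_optimal_ge_fractional:
  assumes opt: "FP_optimal U V E w c n X Z p z zs zt zst"
    and x: "\<And>v. v \<in> V \<Longrightarrow> x v \<in> X v"
    and y: "y \<in> fractional_b_matchings U V E c (\<lambda>v. mean_demand n p v (x v))"
  shows "(\<Sum>e\<in>E. (w e + x (snd e)) * y e) \<le> - FP_objective V E w n X p z zt"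
proof -
  let ?L = "\<lambda>y. \<Sum>e\<in>E. (w e + x (snd e)) * y e"
  obtain y' where y': "y' \<in> fractional_b_matchings U V E c (\<lambda>v. mean_demand n p v (x v))"
    and pos: "\<And>v. v \<in> V \<Longrightarrow> 0 < mean_demand n p v (x v) \<Longrightarrow> 0 < (\<Sum>e\<in>edgesV E v. y' e)"
    using exists_supported_fractional[OF x] by blast
  have "(1 - t) * ?L y + t * ?L y' \<le> - FP_objective V E w n X p z zt" if t: "0 < t" "t < 1" for t
  proof -
    have "?L (\<lambda>e. (1 - t) * y e + t * y' e) \<le> - FP_objective V E w n X p z zt"
    proof (rule FP_optimal_ge_supported[OF opt x])
      show "(\<lambda>e. (1 - t) * y e + t * y' e)
          \<in> fractional_b_matchings U V E c (\<lambda>v. mean_demand n p v (x v))"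
        using y y' t by (intro fractional_b_matchings_convex) auto
      fix v assume v: "v \<in> V" "0 < mean_demand n p v (x v)"
      have "0 \<le> (\<Sum>e\<in>edgesV E v. y e)"
        using y by (intro sum_nonneg) (auto simp: fractional_b_matchings_def edgesV_def)
      then have "0 < (1 - t) * (\<Sum>e\<in>edgesV E v. y e) + t * (\<Sum>e\<in>edgesV E v. y' e)"
        using pos[OF v] t by (intro add_nonneg_pos) auto
      then show "0 < (\<Sum>e\<in>edgesV E v. (1 - t) * y e + t * y' e)"
        by (simp add: sum.distrib sum_distrib_left)
    qed
    moreover have "?L (\<lambda>e. (1 - t) * y e + t * y' e) = (1 - t) * ?L y + t * ?L y'"
      unfolding sum_distrib_left sum.distrib[symmetric]
      by (intro sum.cong refl) (simp add: algebra_simps)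
    ultimately show ?thesis by simp
  qed
  then have "\<forall>\<^sub>F t in at_right 0. (1 - t) * ?L y + t * ?L y' \<le> - FP_objective V E w n X p z zt"
    by (intro eventually_at_rightI[of 0 1]) auto
  moreover have "((\<lambda>t. (1 - t) * ?L y + t * ?L y') \<longlongrightarrow> (1 - 0) * ?L y + 0 * ?L y') (at_right 0)"
    by (intro tendsto_intros)
  ultimately have "(1 - 0) * ?L y + 0 * ?L y' \<le> - FP_objective V E w n X p z zt"
    by (intro tendsto_upperbound) auto
  then show ?thesis by simp
qed

end

section \<open>The approximation guarantee\<close>

theorem mainTheorem1:
  fixes U :: "'u set" and V :: "'v set" and E :: "('u \<times> 'v) set"
    and w :: "'u \<times> 'v \<Rightarrow> real" and c :: "'u \<Rightarrow> nat" and n :: "'v \<Rightarrow> nat"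
    and X Z :: "'v \<Rightarrow> real set" and p :: "'v \<Rightarrow> real \<Rightarrow> real"
    and M :: demand_model
    and z :: "'u \<times> 'v \<Rightarrow> real" and zs :: "'u \<Rightarrow> real" and zt :: "'v \<Rightarrow> real" and zst :: real
    and xopt :: "'v \<Rightarrow> real"
  assumes "finite U" and "finite V" and "E \<subseteq> U \<times> V"
    and "\<forall>u\<in>U. edgesU E u \<noteq> {}" and "\<forall>v\<in>V. edgesV E v \<noteq> {}"
    and "\<forall>u\<in>U. 0 < c u" and "\<forall>v\<in>V. 0 < n v"
    and "\<forall>v\<in>V. is_interval (X v) \<and> X v \<noteq> {}"
    and "\<forall>v\<in>V. Z v \<subseteq> {0..1}" and "\<forall>v\<in>V. p v ` X v \<subseteq> Z v"
    and "\<forall>v\<in>V. \<exists>x\<in>X v. x > - Max (w ` edgesV E v)"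
    and "\<forall>v\<in>V. acceptance_function (X v) (Z v) (p v)"
    and "FP_optimal U V E w c n X Z p z zs zt zst"
    and "\<forall>v\<in>V. xopt v = mean_demand_inv n X p v (\<Sum>e\<in>edgesV E v. z e)"
  shows "(\<forall>v\<in>V. xopt v \<in> X v) \<and>
    (\<forall>x. (\<forall>v\<in>V. x v \<in> X v) \<longrightarrow>
       expected_value M U V E w c n p xopt \<ge> (1 - 1 / exp 1) * expected_value M U V E w c n p x)"
proof -
  interpret priced_graph U V E c n X Z p w
    using assms by unfold_locales auto
  note opt = \<open>FP_optimal U V E w c n X Z p z zs zt zst\<close>
  have feas: "FP_feasible U V E c n Z z zs zt zst" using opt by (simp add: FP_optimal_def)
  have zt: "zt v = (\<Sum>e\<in>edgesV E v. z e)" if "v \<in> V" for v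
    using feas that by (simp add: FP_feasible_def)
  have xopt: "xopt v \<in> X v \<and> mean_demand n p v (xopt v) = (\<Sum>e\<in>edgesV E v. z e)" if v: "v \<in> V" for v
  proof -
    have "(\<Sum>e\<in>edgesV E v. z e) \<in> mean_demand n p v ` X v"
      using feas v unfolding FP_feasible_def demands_eq_image[OF v, symmetric] by blast
    then obtain x where "x \<in> X v" "(\<Sum>e\<in>edgesV E v. z e) = mean_demand n p v x" by blast
    then show ?thesis using assms(14) v mean_demand_inv_mean_demand[OF v] by simp
  qed
  have "mean_at_most (demand_pmf M (n v) (p v (x v))) (mean_demand n p v (x v))"
    "pgf_below_poisson (demand_pmf M (n v) (p v (x v))) (mean_demand n p v (x v))"
    if "v \<in> V" "x v \<in> X v" for v x
    using demand_pmf_mean_and_pgf[OF p_unit[OF that]] by (simp_all add: mean_demand_def)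
  note demand = this
  have opt_eq: "(\<Sum>e\<in>E. (w e + xopt (snd e)) * z e) = - FP_objective V E w n X p z zt"
    using FP_objective_eq[OF zt] zt xopt assms(14) E_subset by (auto intro!: sum.cong)
  have frac: "z \<in> fractional_b_matchings U V E c (\<lambda>v. mean_demand n p v (xopt v))"
    using feas xopt by (auto simp: FP_feasible_def fractional_b_matchings_def)
  have lower: "(1 - 1 / exp 1) * (\<Sum>e\<in>E. (w e + xopt (snd e)) * z e)
      \<le> expected_value M U V E w c n p xopt"
    unfolding expected_value_def demand_dist_def
  proof (rule expected_value_ge_fractional[OF _ frac])
    fix v assume "v \<in> V"
    with xopt show "pgf_below_poisson (demand_pmf M (n v) (p v (xopt v))) (mean_demand n p v (xopt v))"
      by (intro demand(2)) auto
  qed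
  have "(1 - 1 / exp 1) * expected_value M U V E w c n p x \<le> expected_value M U V E w c n p xopt"
    if x: "\<forall>v\<in>V. x v \<in> X v" for x
  proof -
    have mean: "mean_at_most (demand_pmf M (n v) (p v (x v))) (mean_demand n p v (x v))"
      "0 \<le> mean_demand n p v (x v)" if "v \<in> V" for v
      using demand(1) mean_demand_nonneg that x by auto
    obtain y where y: "y \<in> fractional_b_matchings U V E c (\<lambda>v. mean_demand n p v (x v))"
      "expected_value M U V E w c n p x = (\<Sum>e\<in>E. (w e + x (snd e)) * y e)"
      unfolding expected_value_def demand_dist_def
      by (rule expected_value_le_fractional[where w = w and x = x, OF mean]) blast+
    have "expected_value M U V E w c n p x \<le> (\<Sum>e\<in>E. (w e + xopt (snd e)) * z e)"
      using FP_optimal_ge_fractional[OF opt _ y(1)] x y(2) opt_eq by simp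
    then have "(1 - 1 / exp 1) * expected_value M U V E w c n p x
        \<le> (1 - 1 / exp 1) * (\<Sum>e\<in>E. (w e + xopt (snd e)) * z e)"
      by (intro mult_left_mono) auto
    with lower show ?thesis by linarith
  qed
  with xopt show ?thesis by blast
qed

end
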